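(* Let $n\ge 2$ and $i\in\{1,\dots,n-1\}$. (1) For every $\mathbf{k}=(k_1,\dots,k_n)\in\mathbb{Z}^n$ there exists a sijection $\mathrm{GT}(k_1,\dots,k_n)\Rightarrow -\mathrm{GT}(k_1,\dots,k_{i-1},k_{i+1},k_i,k_{i+2},\dots,k_n)$ that is compatible with $\eta_{\mathrm{row}}$. (2) For every $\mathbf{a},\mathbf{b}\in\mathbb{Z}^n$ with $a_i=b_i$ and $a_{i+1}=b_{i+1}$ there exists a sijection $\bigsqcup_{\mathbf{l}\in [a_1,b_1)\times\cdots\times[a_n,b_n)}\mathrm{GT}(\mathbf{l})\Rightarrow(\emptyset,\emptyset)$ that is compatible with $\eta_{\mathrm{row}}$.
   Context: A signed set is a pair $S=(S^+,S^-)$ of disjoint finite sets. Its support is $|S|=S^+\sqcup S^-$ and its size is $\#S=\#S^+-\#S^-$. - The opposite is $-S=(S^-,S^+)$. - The disjoint union is $S\sqcup T=(S^+\sqcup T^+,S^-\sqcup T^-)$. - The Cartesian product is $S\times T=(S^+\times T^+\sqcup S^-\times T^-,\ S^+\times T^-\sqcup S^-\times T^+)$. - For a signed set $T$ and signed sets $S_t$ ($t\in|T|$), the disjoint union with signed index is $\bigsqcup_{t\in T}S_t=\big(\bigsqcup_{t\in T^+}S_t^+\sqcup\bigsqcup_{t\in T^-}S_t^-,\ \bigsqcup_{t\in T^+}S_t^-\sqcup\bigsqcup_{t\in T^-}S_t^+\big)$. Its elements are written $(s,t)$. For $a,b\in\mathbb{Z}$ the signed interval $[a,b)$ is $([a,b)\cap\mathbb{Z},\emptyset)$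 if $a<b$, $(\emptyset,\emptyset)$ if $a=b$, and $(\emptyset,[b,a)\cap\mathbb{Z})$ if $a>b$. Products of signed intervals are signed sets via the Cartesian product. A sijection $\varphi:S\Rightarrow T$ is an involution on $|S|\sqcup|T|$ with $\varphi(S^+\sqcup T^-)=S^-\sqcup T^+$. A statistic is a function on the support. $\varphi$ is compatible with a statistic $\eta$ on $|S|\sqcup|T|$ if $\eta(\varphi(s))=\eta(s)$ for all $s\in|S|\sqcup|T|$. Gelfand–Tsetlin patterns: for $k\in\mathbb{Z}$ set $\mathrm{GT}(k)=(\{k\},\emptyset)$. For $\mathbf{k}\in\mathbb{Z}^n$ with $n\ge2$ set recursively $\mathrm{GT}(\mathbf{k})=\bigsqcup_{\mathbf{l}\in[k_1,k_2)\times\cdots\times[k_{n-1},k_n)}\mathrm{GT}(\mathbf{l})$. An element of $\mathrm{GT}(\mathbf{k})$ is thus a triangular array of integer rows of lengths $1,2,\dots,n$ with bottom row $\mathbf{k}$, together with a sign. Let $\mathrm{MS}(\mathbb{Z},i)$ be the set of multisets of $i$ integers. For an element $T$ of $\mathrm{GT}(\mathbf{k})$, $\mathbf{k}\in\mathbb{Z}^n$, define $\eta_{\mathrm{row}}(T)=(R_1,\dots,R_n)\in\mathrm{MS}(\mathbb{Z},1)\times\cdots\times\mathrm{MS}(\mathbb{Z},n)$, where $R_i$ is the multiset of entries of the $i$-th row of $T$ (row $n$ being $\mathbf{k}$). On a disjoint union with signed index $\bigsqcup_{\mathbf{l}}\mathrm{GT}(\mathbf{l})$ set $\eta_{\mathrm{row}}((T,\mathbf{l}))=\eta_{\mathrm{row}}(T)$.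 *)

theory Defs
  imports Main "HOL-Library.Multiset"
begin

type_synonym 'a sset = "'a set \<times> 'a set"

abbreviation pos :: "'a sset \<Rightarrow> 'a set" where "pos S \<equiv> fst S"
abbreviation neg :: "'a sset \<Rightarrow> 'a set" where "neg S \<equiv> snd S"

definition signed_set :: "'a sset \<Rightarrow> bool" where
  "signed_set S \<longleftrightarrow> finite (pos S) \<and> finite (neg S) \<and> pos S \<inter> neg S = {}"

definition supp :: "'a sset \<Rightarrow> 'a set" where
  "supp S = pos S \<union> neg S"

definition empty_sset :: "'a sset" where
  "empty_sset = ({}, {})"

definition opposite :: "'a sset \<Rightarrow> 'a sset" where
  "opposite S = (neg S, pos S)"

definition sprod :: "'a sset \<Rightarrow> 'b sset \<Rightarrow> ('a \<times> 'b) sset" where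
  "sprod S T = (pos S \<times> pos T \<union> neg S \<times> neg T, pos S \<times> neg T \<union> neg S \<times> pos T)"

definition sUnion :: "'t sset \<Rightarrow> ('t \<Rightarrow> 's sset) \<Rightarrow> ('s \<times> 't) sset" where
  "sUnion T S =
    ({(s, t). t \<in> pos T \<and> s \<in> pos (S t)} \<union> {(s, t). t \<in> neg T \<and> s \<in> neg (S t)},
     {(s, t). t \<in> pos T \<and> s \<in> neg (S t)} \<union> {(s, t). t \<in> neg T \<and> s \<in> pos (S t)})"

lemma sUnion_cong [fundef_cong]:
  assumes "T = T'" and "\<And>t. t \<in> supp T' \<Longrightarrow> S t = S' t"
  shows "sUnion T S = sUnion T' S'"
  using assms unfolding sUnion_def supp_def by auto

text \<open>Renaming of elements. It yields a signed set only for \<open>f\<close> injective on the support;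
  this holds in both uses below, where pairs are re-encoded as lists.\<close>

definition srelabel :: "('a \<Rightarrow> 'b) \<Rightarrow> 'a sset \<Rightarrow> 'b sset" where
  "srelabel f S = (f ` pos S, f ` neg S)"

text \<open>At most one of the two components is nonempty.\<close>

definition sinterval :: "int \<Rightarrow> int \<Rightarrow> int sset" where
  "sinterval a b = ({a..<b}, {b..<a})"

text \<open>\<open>sbox [a\<^sub>1, \<dots>, a\<^sub>n] [b\<^sub>1, \<dots>, b\<^sub>n]\<close> is the product
  \<open>[a\<^sub>1, b\<^sub>1) \<times> \<dots> \<times> [a\<^sub>n, b\<^sub>n)\<close>, with tuples encoded as lists. It is only meant for
  lists of equal length.\<close>

fun sbox :: "int list \<Rightarrow> int list \<Rightarrow> int list sset" where
  "sbox (a # as) (b # bs) = srelabel (\<lambda>(x, xs). x # xs) (sprod (sinterval a b) (sbox as bs))"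
| "sbox _ _ = ({[]}, {})"

lemma length_sbox: "l \<in> supp (sbox as bs) \<Longrightarrow> length l = min (length as) (length bs)"
  by (induction as bs arbitrary: l rule: sbox.induct)
     (fastforce simp: supp_def srelabel_def sprod_def)+

text \<open>An element of \<open>GT k\<close> is the list of rows of the triangular array, from the row of length 1
  to the bottom row \<open>k\<close>; its sign is given by the component it belongs to. An element
  \<open>(T, l)\<close> of the disjoint union is encoded as \<open>T @ [k]\<close>, nothing being lost as \<open>l\<close> is the
  bottom row of \<open>T\<close>. The case \<open>GT []\<close> is a dummy.\<close>

function GT :: "int list \<Rightarrow> int list list sset" where
  "GT [] = empty_sset"
| "GT [k] = ({[[k]]}, {})"
| "GT (k1 # k2 # ks) =
    srelabel (\<lambda>(T, l). T @ [k1 # k2 # ks])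
      (sUnion (sbox (butlast (k1 # k2 # ks)) (tl (k1 # k2 # ks))) (\<lambda>l. GT l))"
  by pat_completeness auto
termination
  by (relation "measure length") (auto simp del: sbox.simps butlast.simps dest!: length_sbox)

lemma signed_set_sUnion:
  assumes "signed_set T" and "\<And>t. t \<in> supp T \<Longrightarrow> signed_set (S t)"
  shows "signed_set (sUnion T S)"
proof -
  have *: "finite {(s, t). t \<in> A \<and> s \<in> f t}"
    if "finite A" "\<And>t. t \<in> A \<Longrightarrow> finite (f t)" for A :: "'a set" and f :: "'a \<Rightarrow> 'b set"
  proof -
    have "{(s, t). t \<in> A \<and> s \<in> f t} = (\<lambda>(t, s). (s, t)) ` (SIGMA t:A. f t)" by auto
    then show ?thesis using that by simp
  qed
  show ?thesis
    using assms unfolding signed_set_def supp_def sUnion_def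
    by (auto intro!: *)
qed

lemma signed_set_srelabel:
  assumes "signed_set S" and "inj_on f (supp S)"
  shows "signed_set (srelabel f S)"
  using assms unfolding signed_set_def srelabel_def supp_def inj_on_def by fastforce

lemma signed_set_sbox: "signed_set (sbox as bs)"
proof (induction as bs rule: sbox.induct)
  case (1 a as b bs)
  have "signed_set (sprod (sinterval a b) (sbox as bs))"
    using 1 by (auto simp: signed_set_def sprod_def sinterval_def)
  then show ?case
    by (auto intro!: signed_set_srelabel simp: inj_on_def)
qed (auto simp: signed_set_def)

lemma GT_rows: "T \<in> supp (GT k) \<Longrightarrow> last T = k \<and> map length T = [1..<Suc (length k)]"
proof (induction k arbitrary: T rule: GT.induct)
  case (3 k1 k2 ks)
  then obtain T' l where l: "l \<in> supp (sbox (butlast (k1 # k2 # ks)) (tl (k1 # k2 # ks)))"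
    and "T' \<in> supp (GT l)" and T: "T = T' @ [k1 # k2 # ks]"
    by (fastforce simp: supp_def srelabel_def sUnion_def)
  with 3 have "map length T' = [1..<Suc (length l)]" by blast
  moreover have "length l = Suc (length ks)" using length_sbox[OF l] by simp
  ultimately show ?case using T by simp
qed (auto simp: supp_def empty_sset_def)

lemma signed_set_GT: "signed_set (GT k)"
proof (induction k rule: GT.induct)
  case (3 k1 k2 ks)
  let ?U = "sUnion (sbox (butlast (k1 # k2 # ks)) (tl (k1 # k2 # ks))) GT"
  have "signed_set ?U"
    using 3 by (intro signed_set_sUnion signed_set_sbox) blast
  moreover have "inj_on (\<lambda>(T, l). T @ [k1 # k2 # ks]) (supp ?U)"
  proof (rule inj_onI)
    have last: "last (fst p) = snd p" if "p \<in> supp ?U" for p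
      using that GT_rows[of "fst p" "snd p"] by (cases p) (auto simp: supp_def sUnion_def)
    fix p q assume "p \<in> supp ?U" "q \<in> supp ?U"
      "(\<lambda>(T, l). T @ [k1 # k2 # ks]) p = (\<lambda>(T, l). T @ [k1 # k2 # ks]) q"
    with last[of p] last[of q] show "p = q" by (auto split: prod.splits)
  qed
  ultimately show ?case
    unfolding GT.simps by (rule signed_set_srelabel)
qed (auto simp: signed_set_def empty_sset_def)

definition sijection :: "'a sset \<Rightarrow> 'b sset \<Rightarrow> ('a + 'b \<Rightarrow> 'a + 'b) \<Rightarrow> bool" where
  "sijection S T \<phi> \<longleftrightarrow>
    signed_set S \<and> signed_set T \<and>
    (\<forall>x \<in> supp S <+> supp T. \<phi> x \<in> supp S <+> supp T \<and> \<phi> (\<phi> x) = x) \<and>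
    \<phi> ` (pos S <+> neg T) = neg S <+> pos T"

definition compatible ::
    "'a sset \<Rightarrow> 'b sset \<Rightarrow> ('a + 'b \<Rightarrow> 'a + 'b) \<Rightarrow> ('a + 'b \<Rightarrow> 'c) \<Rightarrow> bool" where
  "compatible S T \<phi> \<eta> \<longleftrightarrow> (\<forall>x \<in> supp S <+> supp T. \<eta> (\<phi> x) = \<eta> x)"

definition eta_row :: "int list list \<Rightarrow> int multiset list" where
  "eta_row T = map mset T"

definition eta_row_Union :: "int list list \<times> int list \<Rightarrow> int multiset list" where
  "eta_row_Union = (\<lambda>(T, l). eta_row T)"

end

theory Submission
  imports Defs
begin

text \<open>A sijection compatible with a statistic exists as soon as every value of the statistic is
  attained equally often, counted with sign, on both sides. For (1) it therefore suffices that the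
  signed number of patterns with bottom row \<open>k\<close> and prescribed row multisets is antisymmetric in
  \<open>k\<close>. By induction on the number of rows this reduces to the sum of an alternating function over
  \<open>[k\<^sub>1, k\<^sub>2) \<times> \<dots> \<times> [k\<^sub>n\<^sub>-\<^sub>1, k\<^sub>n)\<close>. Exchanging \<open>k\<^sub>i\<close> and \<open>k\<^sub>i\<^sub>+\<^sub>1\<close> replaces consecutive factors
  \<open>A \<times> B \<times> C\<close> by \<open>(A + B) \<times> (- B) \<times> (B + C)\<close>, and all terms of the expansion but \<open>- A \<times> B \<times> C\<close>
  contain the square \<open>B \<times> B\<close> of an interval, over which an alternating function sums to zero.
  In (2) the hypothesis makes the factor \<open>[a\<^sub>i, b\<^sub>i)\<close>, hence the index set, empty.\<close>

section \<open>Sums weighted by sign\<close>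

definition ssum :: "('a \<Rightarrow> int) \<Rightarrow> 'a sset \<Rightarrow> int" where
  "ssum f S = sum f (pos S) - sum f (neg S)"

lemma ssum_cong: "(\<And>x. x \<in> supp S \<Longrightarrow> f x = g x) \<Longrightarrow> ssum f S = ssum g S"
  by (simp add: ssum_def supp_def)

lemma ssum_uminus: "ssum (\<lambda>x. - f x) S = - ssum f S"
  by (simp add: ssum_def sum_negf)

lemma ssum_mult_left: "ssum (\<lambda>x. c * f x) S = c * ssum f S"
  by (simp add: ssum_def sum_distrib_left right_diff_distrib)

lemma ssum_add: "ssum (\<lambda>x. f x + g x) S = ssum f S + ssum g S"
  by (simp add: ssum_def sum.distrib)

lemma ssum_opposite: "ssum f (opposite S) = - ssum f S"
  by (simp add: ssum_def opposite_def)

lemma ssum_swap: "ssum (\<lambda>x. ssum (f x) T) S = ssum (\<lambda>y. ssum (\<lambda>x. f x y) S) T"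
proof -
  have "(\<Sum>x\<in>A. \<Sum>y\<in>B. f x y) = (\<Sum>y\<in>B. \<Sum>x\<in>A. f x y)" for A B
    by (rule sum.swap)
  then show ?thesis
    by (simp add: ssum_def sum_subtractf)
qed

lemma ssum_srelabel:
  assumes "inj_on g (supp S)"
  shows "ssum f (srelabel g S) = ssum (\<lambda>x. f (g x)) S"
proof -
  have "inj_on g (pos S)" "inj_on g (neg S)"
    using assms by (auto simp: supp_def inj_on_Un)
  then show ?thesis
    by (simp add: ssum_def srelabel_def sum.reindex)
qed

text \<open>The sign of \<open>(s, t)\<close> is the product of the signs of \<open>s\<close> and
  \<open>t\<close>, so summation can be iterated.\<close>

lemma ssum_sUnion:
  assumes T: "signed_set T" and S: "\<And>t. t \<in> supp T \<Longrightarrow> signed_set (S t)"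
  shows "ssum f (sUnion T S) = ssum (\<lambda>t. ssum (\<lambda>s. f (s, t)) (S t)) T"
proof -
  have set_eq: "{(s, t). t \<in> A \<and> s \<in> g t} = prod.swap ` (SIGMA t:A. g t)"
    for A and g :: "'a \<Rightarrow> 'b set"
    by auto
  have sum_eq: "sum f {(s, t). t \<in> A \<and> s \<in> g t} = (\<Sum>t\<in>A. \<Sum>s\<in>g t. f (s, t))"
    and fin: "finite {(s, t). t \<in> A \<and> s \<in> g t}"
    if "finite A" "\<And>t. t \<in> A \<Longrightarrow> finite (g t)" for A and g :: "'a \<Rightarrow> 'b set"
    unfolding set_eq using that by (auto simp: sum.reindex sum.Sigma intro!: sum.cong)
  have fins: "finite (pos T)" "finite (neg T)" "pos T \<inter> neg T = {}"
    using T by (auto simp: signed_set_def)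
  have finS: "finite (pos (S t))" "finite (neg (S t))" if "t \<in> pos T \<or> t \<in> neg T" for t
    using S[of t] that by (auto simp: signed_set_def supp_def)
  \<comment> \<open>Both components of \<open>sUnion T S\<close> have this shape; the two pieces are
    disjoint because their index sets are.\<close>
  have union: "sum f ({(s, t). t \<in> pos T \<and> s \<in> g t} \<union> {(s, t). t \<in> neg T \<and> s \<in> h t})
      = (\<Sum>t\<in>pos T. \<Sum>s\<in>g t. f (s, t)) + (\<Sum>t\<in>neg T. \<Sum>s\<in>h t. f (s, t))"
    if "\<And>t. t \<in> pos T \<Longrightarrow> finite (g t)" "\<And>t. t \<in> neg T \<Longrightarrow> finite (h t)"
    for g h :: "'a \<Rightarrow> 'b set"
    using fins that
    by (subst sum.union_disjoint) (auto intro!: fin simp: sum_eq)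
  show ?thesis
    by (simp add: ssum_def sUnion_def union finS sum_subtractf)
qed

lemma ssum_sprod:
  assumes "signed_set S" "signed_set T"
  shows "ssum f (sprod S T) = ssum (\<lambda>x. ssum (\<lambda>y. f (x, y)) T) S"
proof -
  \<comment> \<open>In \<open>sUnion\<close> the index is the second coordinate, so \<open>T\<close>
    becomes the index set and \<open>ssum_swap\<close> restores the order of summation.\<close>
  have "sprod S T = sUnion T (\<lambda>_. S)"
    by (auto simp: sprod_def sUnion_def)
  then show ?thesis
    using assms by (simp add: ssum_sUnion ssum_swap[of _ T S])
qed

section \<open>Sums over signed intervals and their products\<close>

lemma signed_set_sinterval: "signed_set (sinterval a b)"
  by (auto simp: signed_set_def sinterval_def)

lemma ssum_sinterval_flip: "ssum f (sinterval b a) = - ssum f (sinterval a b)"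
  by (simp add: ssum_def sinterval_def)

text \<open>Reversing an interval negates the sum, so additivity for sorted endpoints extends to
  every order of \<open>a\<close>, \<open>b\<close>, \<open>c\<close>.\<close>

lemma ssum_sinterval_add:
  "ssum f (sinterval a c) = ssum f (sinterval a b) + ssum f (sinterval b c)"
proof -
  have split: "sum f {x..<z} = sum f {x..<y} + sum f {y..<z}" if "x \<le> y" "y \<le> z" for x y z :: int
    using that by (subst sum.union_disjoint[symmetric]) (auto simp: ivl_disj_un)
  have sorted: "ssum f (sinterval x z) = ssum f (sinterval x y) + ssum f (sinterval y z)"
    if "x \<le> y" "y \<le> z" for x y z
    using that by (simp add: ssum_def sinterval_def split[of x y z])
  consider "a \<le> b" "b \<le> c" | "a \<le> c" "c \<le> b" | "b \<le> a" "a \<le> c"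
    | "b \<le> c" "c \<le> a" | "c \<le> a" "a \<le> b" | "c \<le> b" "b \<le> a"
    by linarith
  then show ?thesis
    by cases
      (use sorted ssum_sinterval_flip[of f] in \<open>smt (verit)\<close>)+
qed

text \<open>The index set of the union defining \<open>GT k\<close>, also for \<open>k\<close> of length 1.\<close>

definition interlacing :: "int list \<Rightarrow> int list sset" where
  "interlacing k = sbox (butlast k) (tl k)"

lemma interlacing_single: "interlacing [a] = ({[]}, {})"
  by (simp add: interlacing_def)

lemma signed_set_interlacing: "signed_set (interlacing k)"
  by (simp add: interlacing_def signed_set_sbox)

lemma ssum_interlacing_Cons:
  "ssum f (interlacing (a # b # k)) =
    ssum (\<lambda>x. ssum (\<lambda>l. f (x # l)) (interlacing (b # k))) (sinterval a b)"
proof -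
  have "interlacing (a # b # k) =
      srelabel (\<lambda>(x, xs). x # xs) (sprod (sinterval a b) (interlacing (b # k)))"
    by (simp add: interlacing_def)
  moreover have "inj_on (\<lambda>(x, xs). x # xs) A" for A :: "(int \<times> int list) set"
    by (auto simp: inj_on_def)
  ultimately show ?thesis
    by (simp add: ssum_srelabel ssum_sprod signed_set_sinterval signed_set_interlacing)
qed

section \<open>Alternating functions\<close>

definition alternating :: "(int list \<Rightarrow> int) \<Rightarrow> bool" where
  "alternating f \<longleftrightarrow> (\<forall>xs p q ys. f (xs @ p # q # ys) = - f (xs @ q # p # ys))"

lemma alternating_Cons: "alternating f \<Longrightarrow> alternating (\<lambda>l. f (x # l))"
  unfolding alternating_def by (metis append_Cons)

text \<open>Exchanging the two summations shows that the sum equals its own negative.\<close>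

lemma ssum_square_eq_0:
  assumes "\<And>x y. f x y = - f y x"
  shows "ssum (\<lambda>x. ssum (f x) S) S = 0"
proof -
  have "ssum (\<lambda>x. ssum (f x) S) S = ssum (\<lambda>x. ssum (\<lambda>y. - f x y) S) S"
    by (subst ssum_swap) (intro ssum_cong assms)
  then show ?thesis
    by (simp add: ssum_uminus)
qed

text \<open>Removes the terms that contain a square of an interval; \<open>S\<close> stands for the
  remaining factors.\<close>

lemma ssum_interlacing_repeated:
  assumes "alternating f"
  shows "ssum (\<lambda>x. ssum (\<lambda>y. ssum (\<lambda>l. f (x # y # l)) S) (sinterval p q)) (sinterval p q) = 0"
proof (rule ssum_square_eq_0)
  fix x y
  have "f (x # y # l) = - f (y # x # l)" for l
    using assms unfolding alternating_def by (metis append_Nil)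
  then show "ssum (\<lambda>l. f (x # y # l)) S = - ssum (\<lambda>l. f (y # x # l)) S"
    by (simp only: ssum_uminus)
qed

lemma alternating_ssum_interlacing:
  assumes "alternating f"
  shows "ssum f (interlacing (xs @ p # q # ys)) = - ssum f (interlacing (xs @ q # p # ys))"
  using assms
proof (induction xs arbitrary: f)
  case Nil
  show ?case
  proof (cases ys)
    case Nil
    then show ?thesis
      by (simp add: ssum_interlacing_Cons ssum_sinterval_flip[of _ p q] interlacing_single)
  next
    case (Cons w ws)
    \<comment> \<open>Without a factor on the left, \<open>B \<times> C\<close> becomes
      \<open>(- B) \<times> (B + C)\<close>.\<close>
    have "ssum f (interlacing (q # p # w # ws)) = - ssum f (interlacing (p # q # w # ws))"
      using ssum_interlacing_repeated[OF Nil.prems, of "interlacing (w # ws)" p q]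
      by (simp add: ssum_interlacing_Cons ssum_sinterval_flip[of _ q p]
          ssum_sinterval_add[of _ p w q] ssum_add)
    then show ?thesis
      by (simp add: Cons)
  qed
next
  case (Cons u xs)
  note IH = Cons.IH[OF alternating_Cons[OF Cons.prems]]
  show ?case
  proof (cases xs)
    case Nil
    let ?g = "\<lambda>x. ssum (\<lambda>l. f (x # l)) (interlacing (p # q # ys))"
    \<comment> \<open>The factor \<open>[u, p)\<close> can be widened to \<open>[u, q)\<close> at no
      cost, as the added part forms a square with the next factor. What remains is the exchange
      without a left factor, which is \<open>IH\<close>.\<close>
    have "ssum ?g (sinterval p q) = 0"
      using ssum_interlacing_repeated[OF Cons.prems] by (simp add: ssum_interlacing_Cons)
    then have "ssum ?g (sinterval u p) = ssum ?g (sinterval u q)"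
      by (simp add: ssum_sinterval_add[of _ u q p])
    also have "\<dots> = - ssum f (interlacing (u # q # p # ys))"
      using IH by (simp add: Nil ssum_interlacing_Cons[of f u q] ssum_uminus)
    finally show ?thesis
      by (simp add: Nil ssum_interlacing_Cons[of f u p])
  next
    case (Cons u' us)
    \<comment> \<open>The leading factor \<open>[u, u')\<close> does not involve \<open>p\<close>
      and \<open>q\<close>.\<close>
    then show ?thesis
      using IH by (simp add: ssum_interlacing_Cons[of f] ssum_uminus)
  qed
qed

section \<open>Signed counts of patterns with prescribed rows\<close>

definition GT_count :: "int multiset list \<Rightarrow> int list \<Rightarrow> int" where
  "GT_count v k = ssum (\<lambda>T. of_bool (eta_row T = v)) (GT k)"

lemma GT_count_Nil: "GT_count [] k = 0"
proof -
  have "eta_row T \<noteq> []" if "T \<in> supp (GT k)" for T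
  proof
    assume "eta_row T = []"
    then have "k = []"
      using GT_rows[OF that] by (cases k) (auto simp: eta_row_def split: if_splits)
    then show False
      using that by (simp add: supp_def empty_sset_def)
  qed
  then have "GT_count [] k = ssum (\<lambda>_. 0) (GT k)"
    unfolding GT_count_def by (intro ssum_cong) simp
  then show ?thesis
    by (simp add: ssum_def)
qed

text \<open>The last multiset constrains only the bottom row, the others only the pattern above it.
  This is the recursion for the induction on \<open>v\<close> from its end.\<close>

lemma GT_count_snoc:
  "GT_count (v @ [m]) (a # b # k) =
    of_bool (mset (a # b # k) = m) * ssum (GT_count v) (interlacing (a # b # k))"
proof -
  let ?k = "a # b # k"
  have GT_eq: "GT ?k = srelabel (\<lambda>(T, l). T @ [?k]) (sUnion (interlacing ?k) GT)"
    by (simp add: interlacing_def)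
  have "inj_on (\<lambda>(T, l). T @ [?k]) (supp (sUnion (interlacing ?k) GT))"
  proof (rule inj_onI)
    have last: "last (fst P) = snd P" if "P \<in> supp (sUnion (interlacing ?k) GT)" for P
      using that GT_rows[of "fst P" "snd P"] by (cases P) (auto simp: supp_def sUnion_def)
    fix P Q assume "P \<in> supp (sUnion (interlacing ?k) GT)" "Q \<in> supp (sUnion (interlacing ?k) GT)"
      "(\<lambda>(T, l). T @ [?k]) P = (\<lambda>(T, l). T @ [?k]) Q"
    with last[of P] last[of Q] show "P = Q" by (auto split: prod.splits)
  qed
  then have "GT_count (v @ [m]) ?k =
      ssum (\<lambda>l. ssum (\<lambda>T. of_bool (eta_row (T @ [?k]) = v @ [m])) (GT l)) (interlacing ?k)"
    unfolding GT_count_def GT_eq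
    by (simp add: ssum_srelabel ssum_sUnion signed_set_GT signed_set_interlacing)
  also have "(\<lambda>T. of_bool (eta_row (T @ [?k]) = v @ [m]) :: int) =
      (\<lambda>T. of_bool (mset ?k = m) * of_bool (eta_row T = v))"
    by (auto simp: eta_row_def)
  finally show ?thesis
    by (simp only: ssum_mult_left GT_count_def[abs_def])
qed

lemma alternating_GT_count: "alternating (GT_count v)"
proof (induction v rule: rev_induct)
  case Nil
  show ?case
    by (simp add: alternating_def GT_count_Nil)
next
  case (snoc m v)
  have count: "GT_count (v @ [m]) k = of_bool (mset k = m) * ssum (GT_count v) (interlacing k)"
    if "2 \<le> length k" for k
    using that by (cases k rule: GT.cases) (simp_all only: GT_count_snoc, simp_all)
  show ?case
    unfolding alternating_def
  proof (intro allI)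
    fix xs p q ys
    show "GT_count (v @ [m]) (xs @ p # q # ys) = - GT_count (v @ [m]) (xs @ q # p # ys)"
      \<comment> \<open>The factor \<open>of_bool (mset k = m)\<close> is symmetric in the entries
        of \<open>k\<close>, so the sign comes from the sum alone.\<close>
      using alternating_ssum_interlacing[OF snoc, of xs p q ys]
      by (simp add: count add_mset_commute)
  qed
qed

text \<open>Passes from the split lists of \<open>alternating\<close> to the list updates of the
  theorem.\<close>

lemma GT_count_swap:
  assumes "Suc j < length k"
  shows "GT_count v (k[j := k ! Suc j, Suc j := k ! j]) = - GT_count v k"
proof -
  define xs ys where "xs = take j k" and "ys = drop (Suc (Suc j)) k"
  have k: "k = xs @ k ! j # k ! Suc j # ys"
    using assms unfolding xs_def ys_def by (metis Cons_nth_drop_Suc Suc_lessD append_take_drop_id)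
  have len: "length xs = j"
    using assms by (simp add: xs_def)
  have "k[j := k ! Suc j, Suc j := k ! j] = xs @ k ! Suc j # k ! j # ys"
    by (subst (1) k) (simp add: len[symmetric] list_update_append)
  then show ?thesis
    using alternating_GT_count[of v] k unfolding alternating_def by metis
qed

section \<open>From equal counts to sijections\<close>

lemma ex_fibrewise_bij_betw:
  assumes "finite A" "finite B"
    and card: "\<And>v. card {x \<in> A. \<eta> x = v} = card {x \<in> B. \<theta> x = v}"
  obtains g where "bij_betw g A B" "\<And>x. x \<in> A \<Longrightarrow> \<theta> (g x) = \<eta> x"
proof -
  have "\<exists>h. bij_betw h {x \<in> A. \<eta> x = v} {x \<in> B. \<theta> x = v}" for v
    using assms by (intro finite_same_card_bij) auto
  then obtain h where h: "\<And>v. bij_betw (h v) {x \<in> A. \<eta> x = v} {x \<in> B. \<theta> x = v}"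
    by metis
  \<comment> \<open>Glues the bijections between fibres; \<open>\<theta> (g x)\<close> recovers the
    fibre of \<open>x\<close>, whence injectivity.\<close>
  define g where "g x = h (\<eta> x) x" for x
  have g: "g x \<in> B \<and> \<theta> (g x) = \<eta> x" if "x \<in> A" for x
    using bij_betw_apply[OF h[of "\<eta> x"], of x] that by (auto simp: g_def)
  have "inj_on g A"
  proof (rule inj_onI)
    fix x y assume xy: "x \<in> A" "y \<in> A" "g x = g y"
    then have "\<eta> x = \<eta> y"
      using g by metis
    then show "x = y"
      using bij_betw_imp_inj_on[OF h[of "\<eta> x"]] xy by (auto simp: inj_on_def g_def)
  qed
  moreover have "y \<in> g ` A" if "y \<in> B" for y
  proof -
    have "y \<in> h (\<theta> y) ` {x \<in> A. \<eta> x = \<theta> y}"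
      using bij_betw_imp_surj_on[OF h[of "\<theta> y"]] that by auto
    then obtain x where x: "x \<in> A" "\<eta> x = \<theta> y" "h (\<theta> y) x = y"
      by auto
    then have "g x = y"
      by (simp add: g_def)
    then show ?thesis
      using x by blast
  qed
  ultimately have "bij_betw g A B"
    using g by (auto simp: bij_betw_def)
  then show thesis
    using g that by blast
qed

text \<open>Moving the negative terms across the equality of signed counts makes the fibres of
  \<open>?A\<close> and \<open>?B\<close> equally large.\<close>

lemma ex_compatible_sijection:
  assumes S: "signed_set S" and T: "signed_set T"
    and count: "\<And>v. ssum (\<lambda>s. of_bool (\<eta> (Inl s) = v)) S = ssum (\<lambda>t. of_bool (\<eta> (Inr t) = v)) T"
  shows "\<exists>\<phi>. sijection S T \<phi> \<and> compatible S T \<phi> \<eta>"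
proof -
  let ?A = "pos S <+> neg T" and ?B = "neg S <+> pos T"
  have fin: "finite (pos S)" "finite (neg S)" "finite (pos T)" "finite (neg T)"
    and disj: "?A \<inter> ?B = {}"
    using S T by (auto simp: signed_set_def)
  have card_Plus: "card {x \<in> X <+> Y. \<eta> x = v} = card {s \<in> X. \<eta> (Inl s) = v} + card {t \<in> Y. \<eta> (Inr t) = v}"
    if "finite X" "finite Y" for X Y v
  proof -
    have "{x \<in> X <+> Y. \<eta> x = v} = {s \<in> X. \<eta> (Inl s) = v} <+> {t \<in> Y. \<eta> (Inr t) = v}"
      by auto
    then show ?thesis
      using that by (simp add: card_Plus)
  qed
  have card_eq: "card {x \<in> ?A. \<eta> x = v} = card {x \<in> ?B. \<eta> x = v}" for v
    using count[of v] fin by (simp add: card_Plus ssum_def Int_def)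
  obtain g where bij: "bij_betw g ?A ?B" and \<eta>g: "\<And>x. x \<in> ?A \<Longrightarrow> \<eta> (g x) = \<eta> x"
    using ex_fibrewise_bij_betw[OF finite_Plus finite_Plus card_eq] fin by metis
  define g' where "g' = the_inv_into ?A g"
  have bij': "bij_betw g' ?B ?A"
    unfolding g'_def using bij by (rule bij_betw_the_inv_into)
  have g'g: "g' (g x) = x" if "x \<in> ?A" for x
    unfolding g'_def using bij that by (auto simp: the_inv_into_f_f bij_betw_def)
  have gg': "g (g' y) = y" if "y \<in> ?B" for y
    unfolding g'_def using bij that by (intro f_the_inv_into_f_bij_betw)
  \<comment> \<open>A bijection one way and its inverse the other way form an involution, since
    \<open>?A\<close> and \<open>?B\<close> are disjoint.\<close>
  define \<phi> where "\<phi> x = (if x \<in> ?A then g x else g' x)" for x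
  have \<phi>A: "\<phi> x = g x \<and> \<phi> x \<in> ?B" if "x \<in> ?A" for x
    using that bij_betw_apply[OF bij] by (simp add: \<phi>_def)
  have \<phi>B: "\<phi> x = g' x \<and> \<phi> x \<in> ?A" if "x \<in> ?B" for x
    using that disj bij_betw_apply[OF bij', of x] by (auto simp: \<phi>_def)
  have supp: "supp S <+> supp T = ?A \<union> ?B"
    by (auto simp: supp_def)
  have "\<phi> x \<in> ?A \<union> ?B \<and> \<phi> (\<phi> x) = x \<and> \<eta> (\<phi> x) = \<eta> x" if "x \<in> ?A \<union> ?B" for x
  proof (cases "x \<in> ?A")
    case True
    then show ?thesis
      using \<phi>A[OF True] \<phi>B[of "g x"] g'g[OF True] \<eta>g[OF True] by (metis UnI2)
  next
    case False
    then have "x \<in> ?B"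
      using that by blast
    then show ?thesis
      using \<phi>B[of x] \<phi>A[of "g' x"] gg'[of x] \<eta>g[of "g' x"] by (metis UnI1)
  qed
  moreover have "\<phi> ` ?A = ?B"
    using \<phi>A bij_betw_imp_surj_on[OF bij] by (simp cong: image_cong)
  ultimately show ?thesis
    using S T unfolding sijection_def compatible_def supp by blast
qed

section \<open>Empty boxes and the two sijections\<close>

lemma signed_set_opposite: "signed_set (opposite S) \<longleftrightarrow> signed_set S"
  by (auto simp: signed_set_def opposite_def)

text \<open>The factor at position \<open>j\<close> has both components empty, and so has every
  product containing it.\<close>

lemma sbox_eq_empty:
  assumes "j < length a" "j < length b" "a ! j = b ! j"
  shows "sbox a b = empty_sset"
  using assms
proof (induction a b arbitrary: j rule: sbox.induct)
  case (1 a as b bs)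
  then show ?case
    by (cases j) (simp_all add: srelabel_def sprod_def sinterval_def empty_sset_def)
qed (auto)

theorem mainTheorem1:
  fixes n i :: nat
  assumes "n \<ge> 2" and "i \<in> {1..n - 1}"
  shows
    "(\<forall>k :: int list. length k = n \<longrightarrow>
        (\<exists>\<phi>. sijection (GT k) (opposite (GT (k[i - 1 := k ! i, i := k ! (i - 1)]))) \<phi> \<and>
             compatible (GT k) (opposite (GT (k[i - 1 := k ! i, i := k ! (i - 1)]))) \<phi>
               (case_sum eta_row eta_row))) \<and>
     (\<forall>a b :: int list. length a = n \<and> length b = n \<and>
          a ! (i - 1) = b ! (i - 1) \<and> a ! i = b ! i \<longrightarrow>
        (\<exists>\<phi>. sijection (sUnion (sbox a b) GT) (empty_sset :: int list list sset) \<phi> \<and>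
             compatible (sUnion (sbox a b) GT) (empty_sset :: int list list sset) \<phi>
               (case_sum eta_row_Union eta_row)))"
proof (intro conjI allI impI; (elim conjE)?)
  \<comment> \<open>Lists are indexed from 0, so the entries exchanged in (1) are
    \<open>k ! j\<close> and \<open>k ! Suc j\<close>.\<close>
  define j where "j = i - 1"
  have i: "i = Suc j"
    using assms by (simp add: j_def)
  {
    fix k :: "int list"
    assume "length k = n"
    then have "Suc j < length k"
      using assms i by auto
    from GT_count_swap[OF this]
    show "\<exists>\<phi>. sijection (GT k) (opposite (GT (k[i - 1 := k ! i, i := k ! (i - 1)]))) \<phi> \<and>
        compatible (GT k) (opposite (GT (k[i - 1 := k ! i, i := k ! (i - 1)]))) \<phi>
          (case_sum eta_row eta_row)"
      by (intro ex_compatible_sijection)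
        (simp_all add: i signed_set_opposite signed_set_GT ssum_opposite GT_count_def)
  next
    fix a b :: "int list"
    assume "length a = n" "length b = n" "a ! i = b ! i"
    then have "sbox a b = empty_sset"
      using assms by (intro sbox_eq_empty[of i]) auto
    \<comment> \<open>Both sides are empty, so any function serves as \<open>\<phi>\<close>.\<close>
    then show "\<exists>\<phi>. sijection (sUnion (sbox a b) GT) (empty_sset :: int list list sset) \<phi> \<and>
        compatible (sUnion (sbox a b) GT) (empty_sset :: int list list sset) \<phi>
          (case_sum eta_row_Union eta_row)"
      by (simp add: sijection_def compatible_def signed_set_def supp_def sUnion_def empty_sset_def
          Plus_def)
  }
qed

end
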